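(* Let $A \in \mathbf{R}^{n\times n}$ be a stable matrix (every eigenvalue of $A$ has strictly negative real part) and let $V = \{b_1,\dots,b_M\}$ be a finite set of vectors $b_i \in \mathbf{R}^n$ (possible input-matrix columns, i.e. possible actuator locations). For each subset $S \subseteq V$, let $B_S$ be the matrix whose columns are the elements of $S$, and let $$W_S = \int_0^\infty e^{A\tau} B_S B_S^T e^{A^T\tau}\, d\tau \in \mathbf{R}^{n\times n}$$ be the associated controllability Gramian. Then for every weighting matrix $\bar{C} \in \mathbf{R}^{n\times n}$, the set function $f : 2^V \to \mathbf{R}$ defined by $f(S) = \mathrm{tr}(\bar{C} W_S)$ is modular.
   Context: A set function $f : 2^V \to \mathbf{R}$ on a finite set $V$ is called submodular if for all $P, Q \subseteq V$ one has $f(P) + f(Q) \geq f(P \cup Q) + f(P \cap Q)$; it is called supermodular if the reversed inequality holds for all $P, Q \subseteq V$; it is called modular if it is both submodular and supermodular, i.e. if $f(P \cup Q) + f(P \cap Q) = f(P) + f(Q)$ for all $P, Q \subseteq V$. The underlying system is the continuous-time linear time-invariant system $\dot{x}(t) = A x(t) + B_S u(t)$; stability of $A$ is meant in the continuous-time (Hurwitz) sense. For $S = \emptyset$, $B_S$ is the empty ($n \times 0$) matrix, so that $B_\emptyset B_\emptyset^T = 0$ and $W_\emptyset = 0$. The order in which the elements of $S$ are arranged as columns of $B_S$ does not affect $W_S$. *)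

theory Defs
  imports "HOL-Analysis.Analysis" "Jordan_Normal_Form.Char_Poly"
begin

definition submodular_on :: "'a set \<Rightarrow> ('a set \<Rightarrow> real) \<Rightarrow> bool" where
  "submodular_on V f \<longleftrightarrow>
     (\<forall>P Q. P \<subseteq> V \<longrightarrow> Q \<subseteq> V \<longrightarrow> f P + f Q \<ge> f (P \<union> Q) + f (P \<inter> Q))"

definition supermodular_on :: "'a set \<Rightarrow> ('a set \<Rightarrow> real) \<Rightarrow> bool" where
  "supermodular_on V f \<longleftrightarrow>
     (\<forall>P Q. P \<subseteq> V \<longrightarrow> Q \<subseteq> V \<longrightarrow> f P + f Q \<le> f (P \<union> Q) + f (P \<inter> Q))"

definition modular_on :: "'a set \<Rightarrow> ('a set \<Rightarrow> real) \<Rightarrow> bool" where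
  "modular_on V f \<longleftrightarrow> submodular_on V f \<and> supermodular_on V f"

lemma modular_on_iff:
  "modular_on V f \<longleftrightarrow>
     (\<forall>P Q. P \<subseteq> V \<longrightarrow> Q \<subseteq> V \<longrightarrow> f (P \<union> Q) + f (P \<inter> Q) = f P + f Q)"
  by (auto simp: modular_on_def submodular_on_def supermodular_on_def intro: antisym)

text \<open>The eigenvalues of a real matrix are its complex ones.\<close>

definition hurwitz_stable :: "real mat \<Rightarrow> bool" where
  "hurwitz_stable A \<longleftrightarrow> (\<forall>z. eigenvalue (map_mat complex_of_real A) z \<longrightarrow> Re z < 0)"

definition mat_trace :: "'a::comm_monoid_add mat \<Rightarrow> 'a" where
  "mat_trace A = (\<Sum>i<dim_row A. A $$ (i, i))"

text \<open>
  The type of matrices of variable size carries no topology, so the exponential series and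
  the Gramian integral are taken entrywise.
\<close>

definition mat_exp :: "real mat \<Rightarrow> real mat" where
  "mat_exp A = Matrix.mat (dim_row A) (dim_row A) (\<lambda>(i, j). \<Sum>k. (A ^\<^sub>m k) $$ (i, j) / fact k)"

text \<open>
  The columns are put in an arbitrary order; by \<open>input_matrix_gram\<close> below, the product
  of the matrix with its transpose does not depend on it.
  For \<open>S = {}\<close> this is the \<open>n \<times> 0\<close> matrix.
\<close>

definition input_matrix :: "nat \<Rightarrow> real Matrix.vec set \<Rightarrow> real mat" where
  "input_matrix n S = mat_of_cols n (SOME bs. set bs = S \<and> distinct bs)"

definition gramian :: "nat \<Rightarrow> real mat \<Rightarrow> real Matrix.vec set \<Rightarrow> real mat" where
  "gramian n A S = Matrix.mat n n (\<lambda>(i, j). integral {0..} (\<lambda>\<tau>::real.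
     (mat_exp (\<tau> \<cdot>\<^sub>m A) * input_matrix n S * (input_matrix n S)\<^sup>T * mat_exp (\<tau> \<cdot>\<^sub>m A\<^sup>T)) $$ (i, j)))"

lemma mat_of_cols_gram:
  fixes bs :: "real Matrix.vec list"
  assumes "distinct bs"
  shows "mat_of_cols n bs * (mat_of_cols n bs)\<^sup>T
           = Matrix.mat n n (\<lambda>(i, j). \<Sum>b\<in>set bs. vec_index b i * vec_index b j)"
proof (rule eq_matI, goal_cases)
  case (1 i j)
  have "(\<Sum>b\<in>set bs. vec_index b i * vec_index b j)
      = (\<Sum>k<length bs. vec_index (bs ! k) i * vec_index (bs ! k) j)"
    using sum.reindex_bij_betw[OF bij_betw_nth[OF assms refl refl],
        of "\<lambda>b. vec_index b i * vec_index b j"] by simp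
  with 1 show ?case
    by (simp add: scalar_prod_def mat_of_cols_index lessThan_atLeast0)
qed simp_all

lemma input_matrix_gram:
  assumes "set bs = S" "distinct bs"
  shows "input_matrix n S * (input_matrix n S)\<^sup>T = mat_of_cols n bs * (mat_of_cols n bs)\<^sup>T"
proof -
  have "set (SOME bs. set bs = S \<and> distinct bs) = S \<and> distinct (SOME bs. set bs = S \<and> distinct bs)"
    by (rule someI[of "\<lambda>bs. set bs = S \<and> distinct bs" bs]) (use assms in simp)
  then show ?thesis
    using assms by (simp add: input_matrix_def mat_of_cols_gram)
qed

end

theory Submission
  imports Defs "Jordan_Normal_Form.Jordan_Normal_Form_Existence"
begin

text \<open>
  The matrix \<open>B\<^sub>S B\<^sub>S\<^sup>T\<close> is the sum of \<open>b b\<^sup>T\<close> over \<open>b \<in> S\<close>, so \<open>tr (C W\<^sub>S)\<close> is a sum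
  of weights of the elements of \<open>S\<close>, hence modular, as soon as the integral may be taken
  termwise. This needs the products of entries of \<open>e\<^sup>t\<^sup>A\<close> and \<open>e\<^sup>t\<^sup>B\<close>, \<open>B = A\<^sup>T\<close>, to be integrable
  on the half-line: by the Jordan normal form, each entry is a linear combination
  of functions \<open>t\<^sup>m e\<^sup>a\<^sup>t\<close> with \<open>Re a < 0\<close> and so decays exponentially.
\<close>

section \<open>Coefficient sequences whose exponential generating function decays\<close>

text \<open>The function t \<mapsto> sum of t^k / k! * c k is represented by its coefficients: for
  entries of \<open>A ^\<^sub>m k\<close> it is an entry of e^(tA). Convergence at every t \<ge> 0
  is part of the predicate, so closure under linear operations also yields convergence of the
  combined series.\<close>

definition exp_decaying :: "(nat \<Rightarrow> 'a::{real_normed_field,banach}) \<Rightarrow> bool" where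
  "exp_decaying c \<longleftrightarrow> (\<exists>C. \<exists>\<alpha>>0. \<forall>t\<ge>0. \<exists>s.
     (\<lambda>k. (t ^ k / fact k) *\<^sub>R c k) sums s \<and> norm s \<le> C * exp (- \<alpha> * t))"

lemma exp_decaying_zero: "exp_decaying (\<lambda>_. 0)"
  unfolding exp_decaying_def
  by (rule exI[of _ 0], rule exI[of _ 1]) (auto intro!: exI[of _ 0])

lemma exp_decaying_add:
  assumes "exp_decaying c" "exp_decaying d"
  shows "exp_decaying (\<lambda>k. c k + d k)"
proof -
  from assms(1) obtain C \<alpha> where \<alpha>: "\<alpha> > 0"
    and c: "\<And>t. t \<ge> 0 \<Longrightarrow> \<exists>s. (\<lambda>k. (t ^ k / fact k) *\<^sub>R c k) sums s \<and> norm s \<le> C * exp (- \<alpha> * t)"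
    unfolding exp_decaying_def by blast
  from assms(2) obtain D \<beta> where \<beta>: "\<beta> > 0"
    and d: "\<And>t. t \<ge> 0 \<Longrightarrow> \<exists>s. (\<lambda>k. (t ^ k / fact k) *\<^sub>R d k) sums s \<and> norm s \<le> D * exp (- \<beta> * t)"
    unfolding exp_decaying_def by blast
  \<comment> \<open>Both bounds are relaxed to the slower of the two rates. Enlarging the
    exponential needs a nonnegative constant, hence the absolute value.\<close>
  have weaken: "x \<le> \<bar>K\<bar> * exp (- min \<alpha> \<beta> * t)"
    if "x \<le> K * exp (- \<gamma> * t)" "min \<alpha> \<beta> \<le> \<gamma>" "t \<ge> 0" for x K \<gamma> t :: real
  proof -
    have "K * exp (- \<gamma> * t) \<le> \<bar>K\<bar> * exp (- min \<alpha> \<beta> * t)"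
      using that by (intro mult_mono) (auto intro!: mult_right_mono)
    with that(1) show ?thesis by linarith
  qed
  have "\<exists>s. (\<lambda>k. (t ^ k / fact k) *\<^sub>R (c k + d k)) sums s \<and>
      norm s \<le> (\<bar>C\<bar> + \<bar>D\<bar>) * exp (- min \<alpha> \<beta> * t)" if t: "t \<ge> 0" for t
  proof -
    from c[OF t] obtain s where s: "(\<lambda>k. (t ^ k / fact k) *\<^sub>R c k) sums s"
      "norm s \<le> C * exp (- \<alpha> * t)" by blast
    from d[OF t] obtain r where r: "(\<lambda>k. (t ^ k / fact k) *\<^sub>R d k) sums r"
      "norm r \<le> D * exp (- \<beta> * t)" by blast
    have "norm (s + r) \<le> (\<bar>C\<bar> + \<bar>D\<bar>) * exp (- min \<alpha> \<beta> * t)"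
      using weaken[OF s(2) _ t] weaken[OF r(2) _ t] norm_triangle_ineq[of s r]
      by (simp add: distrib_right)
    with sums_add[OF s(1) r(1)] show ?thesis
      by (auto simp: scaleR_add_right)
  qed
  moreover have "min \<alpha> \<beta> > 0" using \<alpha> \<beta> by simp
  ultimately show ?thesis
    unfolding exp_decaying_def by blast
qed

lemma exp_decaying_cmult:
  assumes "exp_decaying c"
  shows "exp_decaying (\<lambda>k. z * c k)"
proof -
  from assms obtain C \<alpha> where \<alpha>: "\<alpha> > 0"
    and c: "\<And>t. t \<ge> 0 \<Longrightarrow> \<exists>s. (\<lambda>k. (t ^ k / fact k) *\<^sub>R c k) sums s \<and> norm s \<le> C * exp (- \<alpha> * t)"
    unfolding exp_decaying_def by blast
  have "\<exists>s. (\<lambda>k. (t ^ k / fact k) *\<^sub>R (z * c k)) sums s \<and> norm s \<le> (norm z * C) * exp (- \<alpha> * t)"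
    if t: "t \<ge> 0" for t
  proof -
    from c[OF t] obtain s where s: "(\<lambda>k. (t ^ k / fact k) *\<^sub>R c k) sums s"
      "norm s \<le> C * exp (- \<alpha> * t)" by blast
    from s(2) have "norm (z * s) \<le> (norm z * C) * exp (- \<alpha> * t)"
      by (simp add: norm_mult mult.assoc mult_left_mono)
    with sums_mult[OF s(1), of z] show ?thesis by auto
  qed
  with \<alpha> show ?thesis unfolding exp_decaying_def by blast
qed

lemma exp_decaying_sum:
  assumes "\<And>i. i \<in> I \<Longrightarrow> exp_decaying (c i)"
  shows "exp_decaying (\<lambda>k. \<Sum>i\<in>I. c i k)"
  using assms
  by (induction I rule: infinite_finite_induct) (auto intro: exp_decaying_zero exp_decaying_add)

text \<open>The way back from the complex Jordan form to the real matrix: taking real parts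
  preserves convergence and does not increase the norm.\<close>

lemma exp_decaying_of_realD:
  assumes "exp_decaying (\<lambda>k. complex_of_real (c k))"
  shows "exp_decaying c"
proof -
  from assms obtain C \<alpha> where \<alpha>: "\<alpha> > 0"
    and c: "\<And>t. t \<ge> 0 \<Longrightarrow> \<exists>s. (\<lambda>k. (t ^ k / fact k) *\<^sub>R complex_of_real (c k)) sums s
                            \<and> norm s \<le> C * exp (- \<alpha> * t)"
    unfolding exp_decaying_def by blast
  have "\<exists>s. (\<lambda>k. (t ^ k / fact k) *\<^sub>R c k) sums s \<and> norm s \<le> C * exp (- \<alpha> * t)"
    if t: "t \<ge> 0" for t
  proof -
    from c[OF t] obtain s where s: "(\<lambda>k. (t ^ k / fact k) *\<^sub>R complex_of_real (c k)) sums s"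
      "norm s \<le> C * exp (- \<alpha> * t)" by blast
    from sums_Re[OF s(1)] have "(\<lambda>k. (t ^ k / fact k) *\<^sub>R c k) sums Re s" by simp
    moreover have "norm (Re s) \<le> C * exp (- \<alpha> * t)"
      using abs_Re_le_cmod[of s] s(2) by simp
    ultimately show ?thesis by blast
  qed
  with \<alpha> show ?thesis unfolding exp_decaying_def by blast
qed

section \<open>Decay for Jordan blocks and Jordan matrices\<close>

lemma power_div_fact_le_exp:
  fixes x :: real
  assumes "x \<ge> 0"
  shows "x ^ m / fact m \<le> exp x"
proof -
  have "x ^ m / fact m = (\<Sum>k\<in>{m}. x ^ k /\<^sub>R fact k)"
    by (simp add: divide_inverse mult.commute)
  also have "\<dots> \<le> (\<Sum>k. x ^ k /\<^sub>R fact k)"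
    using assms by (intro sum_le_suminf summable_exp_generic) auto
  finally show ?thesis by (simp add: exp_def)
qed

text \<open>The \<open>m\<close>-th superdiagonal of a Jordan block contributes \<open>t ^ m / m! * e ^ (a t)\<close> to its exponential.\<close>

lemma exp_decaying_binomial:
  fixes a :: complex
  assumes a: "Re a < 0"
  shows "exp_decaying (\<lambda>k. of_nat (k choose m) * a ^ (k - m))"
proof -
  \<comment> \<open>Half of the decay rate of e^(a t) is kept. The other half absorbs t^m through
    (\<alpha> t)^m / m! \<le> e^(\<alpha> t), and this rescaling of t produces the factor
    \<open>inverse (\<alpha> ^ m)\<close>.\<close>
  define \<alpha> where "\<alpha> = - Re a / 2"
  have \<alpha>: "\<alpha> > 0" using a by (simp add: \<alpha>_def)
  have "\<exists>s. (\<lambda>k. (t ^ k / fact k) *\<^sub>R (of_nat (k choose m) * a ^ (k - m))) sums s \<and>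
      norm s \<le> inverse (\<alpha> ^ m) * exp (- \<alpha> * t)" if t: "t \<ge> 0" for t
  proof -
    let ?f = "\<lambda>k. (t ^ k / fact k) *\<^sub>R (of_nat (k choose m) * a ^ (k - m))"
    let ?s = "of_real (t ^ m / fact m) * exp (of_real t * a)"
    \<comment> \<open>Dividing \<open>k choose m\<close> by k! leaves 1 / (m! (k - m)!), so from
      index \<open>m\<close> on the series is t^m / m! times the exponential series of t a.\<close>
    have shift: "?f (i + m) = of_real (t ^ m / fact m) * ((of_real t * a) ^ i /\<^sub>R fact i)" for i
    proof -
      have "of_nat (i + m choose m) = (fact (i + m) / (fact m * fact i) :: complex)"
        using binomial_fact[of m "i + m", where 'a = complex] by simp
      then show ?thesis
        by (simp add: scaleR_conv_of_real power_add power_mult_distrib field_simps)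
    qed
    have "(\<lambda>i. ?f (i + m)) sums ?s"
      unfolding shift by (intro sums_mult exp_converges)
    \<comment> \<open>The terms cut off by the shift vanish: for k < m the binomial coefficient is
      0, and the truncated exponent \<open>k - m\<close> does no harm.\<close>
    then have "?f sums ?s"
      by (subst (asm) sums_zero_iff_shift) auto
    moreover have "norm ?s \<le> inverse (\<alpha> ^ m) * exp (- \<alpha> * t)"
    proof -
      have "norm ?s = t ^ m / fact m * exp (- (2 * \<alpha>) * t)"
        using t by (simp add: norm_mult norm_divide norm_power \<alpha>_def mult.commute)
      also have "\<dots> = inverse (\<alpha> ^ m) * ((\<alpha> * t) ^ m / fact m) * exp (- (2 * \<alpha>) * t)"
        using \<alpha> by (simp add: power_mult_distrib field_simps)
      also have "\<dots> \<le> inverse (\<alpha> ^ m) * exp (\<alpha> * t) * exp (- (2 * \<alpha>) * t)"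
        using \<alpha> t by (intro mult_right_mono mult_left_mono power_div_fact_le_exp) auto
      also have "\<dots> = inverse (\<alpha> ^ m) * exp (- \<alpha> * t)"
        by (simp add: mult.assoc flip: exp_add)
      finally show ?thesis .
    qed
    ultimately show ?thesis by blast
  qed
  with \<alpha> show ?thesis unfolding exp_decaying_def by blast
qed

lemma exp_decaying_jordan_block:
  fixes a :: complex
  assumes "Re a < 0" "i < m" "j < m"
  shows "exp_decaying (\<lambda>k. (jordan_block m a ^\<^sub>m k) $$ (i, j))"
proof (cases "i \<le> j")
  case True
  have "(jordan_block m a ^\<^sub>m k) $$ (i, j) = of_nat (k choose (j - i)) * a ^ (k - (j - i))" for k
    using True assms by (simp add: jordan_block_pow)
  with exp_decaying_binomial[OF assms(1), of "j - i"] show ?thesis by simp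
next
  case False
  with assms show ?thesis by (simp add: jordan_block_pow exp_decaying_zero)
qed

text \<open>Powers of a block diagonal matrix are taken block by block. An entry lies in the first
  block, in an off-diagonal zero block, or, after shifting both indices by \<open>m\<close>, in the
  remaining Jordan matrix.\<close>

lemma exp_decaying_jordan_matrix:
  fixes n_as :: "(nat \<times> complex) list"
  assumes "\<And>m a. (m, a) \<in> set n_as \<Longrightarrow> Re a < 0"
    and "i < sum_list (map fst n_as)" "j < sum_list (map fst n_as)"
  shows "exp_decaying (\<lambda>k. (jordan_matrix n_as ^\<^sub>m k) $$ (i, j))"
  using assms
proof (induction n_as arbitrary: i j)
  case Nil
  then show ?case by simp
next
  case (Cons ma n_as)
  obtain m a where ma: "ma = (m, a)" by force
  have dim: "dim_row (jordan_matrix n_as ^\<^sub>m k) = sum_list (map fst n_as)"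
    "dim_col (jordan_matrix n_as ^\<^sub>m k) = sum_list (map fst n_as)" for k
    by (simp_all add: pow_mat_dim_square[of _ "sum_list (map fst n_as)"] carrier_matI)
  have "(jordan_matrix (ma # n_as) ^\<^sub>m k) $$ (i, j) =
     (if i < m then if j < m then (jordan_block m a ^\<^sub>m k) $$ (i, j) else 0
      else if j < m then 0 else (jordan_matrix n_as ^\<^sub>m k) $$ (i - m, j - m))" for k
    using Cons.prems(2,3) dim[of k]
    by (simp add: jordan_matrix_pow ma Let_def)
  moreover have "Re a < 0" by (rule Cons.prems(1)[of m]) (simp add: ma)
  moreover have "exp_decaying (\<lambda>k. (jordan_matrix n_as ^\<^sub>m k) $$ (i - m, j - m))"
    if "m \<le> i" "m \<le> j"
    using that Cons.prems ma by (intro Cons.IH) auto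
  ultimately show ?case
    by (cases "i < m"; cases "j < m") (simp_all add: exp_decaying_zero exp_decaying_jordan_block)
qed

section \<open>Decay for stable matrices\<close>

lemma mult_mat_index_sum:
  assumes "A \<in> carrier_mat n m" "B \<in> carrier_mat m r" "i < n" "j < r"
  shows "(A * B) $$ (i, j) = (\<Sum>l<m. A $$ (i, l) * B $$ (l, j))"
  using assms by (simp add: scalar_prod_def lessThan_atLeast0)

lemma mult_mat_mat_index_sum:
  assumes "A \<in> carrier_mat n m" "B \<in> carrier_mat m r" "C \<in> carrier_mat r s" "i < n" "j < s"
  shows "(A * B * C) $$ (i, j) = (\<Sum>q<r. (\<Sum>p<m. A $$ (i, p) * B $$ (p, q)) * C $$ (q, j))"
  using assms mult_mat_index_sum[OF mult_carrier_mat[OF assms(1,2)] assms(3)]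
    mult_mat_index_sum[OF assms(1,2)] by simp

text \<open>Over the complex numbers A^k = P J^k Q with \<open>P\<close> and \<open>Q\<close>
  independent of k, so each entry of A^k is a fixed linear combination of entries of J^k.\<close>

lemma hurwitz_stable_exp_decaying:
  assumes A: "A \<in> carrier_mat n n" and stable: "hurwitz_stable A" and ij: "i < n" "j < n"
  shows "exp_decaying (\<lambda>k. (A ^\<^sub>m k) $$ (i, j))"
proof (rule exp_decaying_of_realD)
  let ?A = "map_mat complex_of_real A"
  have A': "?A \<in> carrier_mat n n" using A by simp
  obtain n_as where jnf: "jordan_nf ?A n_as"
    using char_poly_factorized[OF A'] jordan_nf_exists[OF A'] by blast
  obtain P Q where P: "P \<in> carrier_mat n n" and Q: "Q \<in> carrier_mat n n"
    and cp: "char_poly ?A = (\<Prod>(m, a)\<leftarrow>n_as. [:- a, 1:] ^ m)"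
    and pow: "\<And>k. ?A ^\<^sub>m k = P * jordan_matrix n_as ^\<^sub>m k * Q"
    using jordan_nf_powE[OF A' jnf] by blast
  \<comment> \<open>A block of positive size contributes a factor vanishing at \<open>a\<close> to
    the characteristic polynomial, so \<open>a\<close> is an eigenvalue and stability
    applies.\<close>
  have Re_neg: "Re a < 0" if "(m, a) \<in> set n_as" for m a
  proof -
    have "m \<noteq> 0" using jnf that by (force simp: jordan_nf_def)
    then have "poly (char_poly ?A) a = 0"
      using that unfolding cp poly_prod_list by (force simp: prod_list_zero_iff)
    then show ?thesis
      using stable eigenvalue_root_char_poly[OF A'] by (simp add: hurwitz_stable_def)
  qed
  have N: "sum_list (map fst n_as) = n"
    using jnf A' by (auto simp: jordan_nf_def similar_mat_def similar_mat_wit_def Let_def)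
  have J: "jordan_matrix n_as ^\<^sub>m k \<in> carrier_mat n n" for k
    by (rule pow_carrier_mat) (simp add: carrier_matI N)
  have "complex_of_real ((A ^\<^sub>m k) $$ (i, j)) =
      (\<Sum>q<n. Q $$ (q, j) * (\<Sum>p<n. P $$ (i, p) * (jordan_matrix n_as ^\<^sub>m k) $$ (p, q)))" for k
  proof -
    have "complex_of_real ((A ^\<^sub>m k) $$ (i, j)) = map_mat complex_of_real (A ^\<^sub>m k) $$ (i, j)"
      using A ij by simp
    also have "\<dots> = (P * jordan_matrix n_as ^\<^sub>m k * Q) $$ (i, j)"
      by (simp only: of_real_hom.mat_hom_pow[OF A] pow)
    also have "\<dots> = (\<Sum>q<n. Q $$ (q, j) * (\<Sum>p<n. P $$ (i, p) * (jordan_matrix n_as ^\<^sub>m k) $$ (p, q)))"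
      by (simp only: mult_mat_mat_index_sum[OF P J Q ij] mult.commute)
    finally show ?thesis .
  qed
  then show "exp_decaying (\<lambda>k. complex_of_real ((A ^\<^sub>m k) $$ (i, j)))"
    by (auto intro!: exp_decaying_sum exp_decaying_cmult exp_decaying_jordan_matrix Re_neg simp: N)
qed

section \<open>Integrability on the half-line\<close>

lemma exp_decaying_continuous:
  fixes c :: "nat \<Rightarrow> real"
  assumes "exp_decaying c"
  shows "continuous_on {0..} (\<lambda>t. \<Sum>k. (t ^ k / fact k) * c k)"
proof -
  have summable: "summable (\<lambda>k. c k / fact k * K ^ k)" if "K \<ge> 0" for K
    using assms that unfolding exp_decaying_def
    by (auto simp: sums_iff mult.commute)
  \<comment> \<open>Continuity of a power series at t needs convergence at some point of larger
    modulus; t + 1 serves.\<close>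
  have "isCont (\<lambda>t. \<Sum>k. c k / fact k * t ^ k) t" if "t \<ge> 0" for t
    by (rule isCont_powser[OF summable[of "t + 1"]]) (use that in auto)
  then show ?thesis
    by (auto intro!: continuous_at_imp_continuous_on simp: mult.commute)
qed

lemma exp_decaying_bound:
  fixes c :: "nat \<Rightarrow> real"
  assumes "exp_decaying c"
  obtains C \<alpha> where "\<alpha> > 0" "\<And>t. t \<ge> 0 \<Longrightarrow> \<bar>\<Sum>k. (t ^ k / fact k) * c k\<bar> \<le> C * exp (- \<alpha> * t)"
  using assms unfolding exp_decaying_def by (force simp: sums_iff)

text \<open>Continuity gives measurability, and the two exponential bounds multiply to an integrable
  majorant of rate \<alpha> + \<beta>.\<close>

lemma exp_decaying_mult_integrable:
  fixes c d :: "nat \<Rightarrow> real"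
  assumes "exp_decaying c" "exp_decaying d"
  shows "(\<lambda>t. (\<Sum>k. (t ^ k / fact k) * c k) * (\<Sum>k. (t ^ k / fact k) * d k)) integrable_on {0..}"
    (is "(\<lambda>t. ?f t * ?g t) integrable_on _")
proof -
  obtain C \<alpha> where \<alpha>: "\<alpha> > 0" and f: "\<And>t. t \<ge> 0 \<Longrightarrow> \<bar>?f t\<bar> \<le> C * exp (- \<alpha> * t)"
    using exp_decaying_bound[OF assms(1)] by blast
  obtain D \<beta> where \<beta>: "\<beta> > 0" and g: "\<And>t. t \<ge> 0 \<Longrightarrow> \<bar>?g t\<bar> \<le> D * exp (- \<beta> * t)"
    using exp_decaying_bound[OF assms(2)] by blast
  show ?thesis
  proof (rule measurable_bounded_by_integrable_imp_integrable)
    show "(\<lambda>t. ?f t * ?g t) \<in> borel_measurable (lebesgue_on {0..})"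
      by (intro continuous_imp_measurable_on_sets_lebesgue continuous_on_mult
          exp_decaying_continuous assms) simp
    show "(\<lambda>t. C * D * exp (- (\<alpha> + \<beta>) * t)) integrable_on {0..}"
      using \<alpha> \<beta> by (intro integrable_on_mult_right integrable_on_exp_minus_to_infinity) simp
    show "norm (?f t * ?g t) \<le> C * D * exp (- (\<alpha> + \<beta>) * t)" if "t \<in> {0..}" for t
    proof -
      \<comment> \<open>Monotonicity of the product needs C e^(-\<alpha> t) \<ge> 0, which holds
        because this bound dominates an absolute value.\<close>
      have "\<bar>?f t\<bar> * \<bar>?g t\<bar> \<le> (C * exp (- \<alpha> * t)) * (D * exp (- \<beta> * t))"
        using f[of t] g[of t] that by (intro mult_mono) (auto intro: order_trans[OF abs_ge_zero])
      also have "\<dots> = C * D * exp (- (\<alpha> + \<beta>) * t)"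
        by (simp add: distrib_right exp_add exp_minus exp_diff field_simps)
      finally show ?thesis by (simp add: abs_mult)
    qed
  qed simp
qed

section \<open>Entries of the matrix exponential, and transposition\<close>

lemma smult_mat_pow:
  fixes A :: "'a::comm_semiring_1 mat"
  assumes A: "A \<in> carrier_mat n n"
  shows "(t \<cdot>\<^sub>m A) ^\<^sub>m k = t ^ k \<cdot>\<^sub>m (A ^\<^sub>m k)"
proof (induction k)
  case 0
  show ?case by (rule eq_matI) auto
next
  case (Suc k)
  have "A ^\<^sub>m k \<in> carrier_mat n n" using A by simp
  with Suc A have "(t \<cdot>\<^sub>m A) ^\<^sub>m Suc k = t \<cdot>\<^sub>m (t ^ k \<cdot>\<^sub>m (A ^\<^sub>m Suc k))"
    by (simp add: mult_smult_assoc_mat[of _ n n] mult_smult_distrib[of _ n n])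
  also have "\<dots> = t ^ Suc k \<cdot>\<^sub>m (A ^\<^sub>m Suc k)"
    by (rule eq_matI) (simp_all add: mult_ac)
  finally show ?case .
qed

lemma mat_exp_smult_index:
  assumes A: "A \<in> carrier_mat n n" and "i < n" "j < n"
  shows "mat_exp (t \<cdot>\<^sub>m A) $$ (i, j) = (\<Sum>k. (t ^ k / fact k) * (A ^\<^sub>m k) $$ (i, j))"
proof -
  have "A ^\<^sub>m k \<in> carrier_mat n n" for k using A by simp
  with assms show ?thesis
    by (simp add: mat_exp_def smult_mat_pow[OF A] carrier_matD)
qed

text \<open>A matrix and its transpose have the same characteristic polynomial. This makes the decay
  result available for the right factor e^(t A^T) of the Gramian integrand, which is a series in
  A^T.\<close>

lemma hurwitz_stable_transpose:
  assumes A: "A \<in> carrier_mat n n" and "hurwitz_stable A"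
  shows "hurwitz_stable A\<^sup>T"
proof -
  have B: "map_mat complex_of_real A \<in> carrier_mat n n" using A by simp
  have "map_mat complex_of_real A\<^sup>T = (map_mat complex_of_real A)\<^sup>T" by auto
  then have "eigenvalue (map_mat complex_of_real A\<^sup>T) z = eigenvalue (map_mat complex_of_real A) z" for z
    using eigenvalue_root_char_poly[OF B] B
      eigenvalue_root_char_poly[of "(map_mat complex_of_real A)\<^sup>T" n]
    by (simp add: char_poly_transpose_mat[OF B])
  with assms(2) show ?thesis by (simp add: hurwitz_stable_def)
qed

section \<open>The Gramian as a sum over actuators, and modularity\<close>

text \<open>Each b enters the integrand only through the constants b_p b_q, so linearity pulls them
  out; the remaining integrals depend neither on b nor on S.\<close>

lemma gramian_index:
  assumes A: "A \<in> carrier_mat n n" and stable: "hurwitz_stable A"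
    and S: "finite S" and ij: "i < n" "j < n"
  shows "gramian n A S $$ (i, j) = (\<Sum>b\<in>S. \<Sum>q<n. \<Sum>p<n.
    vec_index b p * vec_index b q *
    integral {0..} (\<lambda>t. mat_exp (t \<cdot>\<^sub>m A) $$ (i, p) * mat_exp (t \<cdot>\<^sub>m A\<^sup>T) $$ (q, j)))"
proof -
  have AT: "A\<^sup>T \<in> carrier_mat n n" using A by simp
  have E: "mat_exp (t \<cdot>\<^sub>m A) \<in> carrier_mat n n" "mat_exp (t \<cdot>\<^sub>m A\<^sup>T) \<in> carrier_mat n n" for t
    using A by (auto simp: mat_exp_def)
  obtain bs where bs: "set bs = S" "distinct bs"
    using finite_distinct_list[OF S] by blast
  \<comment> \<open>\<open>G\<close> is B_S B_S^T written without reference to the chosen column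
    order.\<close>
  define G where "G = Matrix.mat n n (\<lambda>(p, q). \<Sum>b\<in>S. vec_index b p * vec_index b q)"
  \<comment> \<open>The width is the length of the chosen list; knowing it in this form is enough
    for associativity of the product.\<close>
  have I: "input_matrix n S \<in> carrier_mat n (length (SOME bs. set bs = S \<and> distinct bs))"
    by (simp add: input_matrix_def)
  have G: "input_matrix n S * (input_matrix n S)\<^sup>T = G"
    using input_matrix_gram[OF bs] mat_of_cols_gram[OF bs(2)] bs(1) by (simp add: G_def)
  have integrable: "(\<lambda>t. mat_exp (t \<cdot>\<^sub>m A) $$ (i, p) * mat_exp (t \<cdot>\<^sub>m A\<^sup>T) $$ (q, j)) integrable_on {0..}"
    if "p < n" "q < n" for p q
    using that ij
    unfolding mat_exp_smult_index[OF A ij(1) that(1)] mat_exp_smult_index[OF AT that(2) ij(2)]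
    by (intro exp_decaying_mult_integrable hurwitz_stable_exp_decaying[OF A stable]
        hurwitz_stable_exp_decaying[OF AT hurwitz_stable_transpose[OF A stable]])
  have integrand: "(mat_exp (t \<cdot>\<^sub>m A) * input_matrix n S * (input_matrix n S)\<^sup>T * mat_exp (t \<cdot>\<^sub>m A\<^sup>T)) $$ (i, j)
     = (\<Sum>b\<in>S. \<Sum>q<n. \<Sum>p<n. vec_index b p * vec_index b q *
         (mat_exp (t \<cdot>\<^sub>m A) $$ (i, p) * mat_exp (t \<cdot>\<^sub>m A\<^sup>T) $$ (q, j)))" for t
  proof -
    have "mat_exp (t \<cdot>\<^sub>m A) * input_matrix n S * (input_matrix n S)\<^sup>T = mat_exp (t \<cdot>\<^sub>m A) * G"
      unfolding G[symmetric] using E(1) I by (intro assoc_mult_mat) auto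
    moreover have "G \<in> carrier_mat n n" by (simp add: G_def)
    ultimately have "(mat_exp (t \<cdot>\<^sub>m A) * input_matrix n S * (input_matrix n S)\<^sup>T * mat_exp (t \<cdot>\<^sub>m A\<^sup>T)) $$ (i, j)
      = (\<Sum>q<n. (\<Sum>p<n. mat_exp (t \<cdot>\<^sub>m A) $$ (i, p) * G $$ (p, q)) * mat_exp (t \<cdot>\<^sub>m A\<^sup>T) $$ (q, j))"
      using mult_mat_mat_index_sum[OF E(1) _ E(2) ij] by simp
    also have "\<dots> = (\<Sum>q<n. \<Sum>p<n. \<Sum>b\<in>S. vec_index b p * vec_index b q *
         (mat_exp (t \<cdot>\<^sub>m A) $$ (i, p) * mat_exp (t \<cdot>\<^sub>m A\<^sup>T) $$ (q, j)))"
      by (simp add: G_def sum_distrib_left sum_distrib_right mult_ac)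
    also have "\<dots> = (\<Sum>q<n. \<Sum>b\<in>S. \<Sum>p<n. vec_index b p * vec_index b q *
         (mat_exp (t \<cdot>\<^sub>m A) $$ (i, p) * mat_exp (t \<cdot>\<^sub>m A\<^sup>T) $$ (q, j)))"
      by (intro sum.cong refl sum.swap)
    also have "\<dots> = (\<Sum>b\<in>S. \<Sum>q<n. \<Sum>p<n. vec_index b p * vec_index b q *
         (mat_exp (t \<cdot>\<^sub>m A) $$ (i, p) * mat_exp (t \<cdot>\<^sub>m A\<^sup>T) $$ (q, j)))"
      by (rule sum.swap)
    finally show ?thesis .
  qed
  have "gramian n A S $$ (i, j) = integral {0..} (\<lambda>t. \<Sum>b\<in>S. \<Sum>q<n. \<Sum>p<n. vec_index b p * vec_index b q *
         (mat_exp (t \<cdot>\<^sub>m A) $$ (i, p) * mat_exp (t \<cdot>\<^sub>m A\<^sup>T) $$ (q, j)))"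
    using ij by (simp add: gramian_def integrand)
  \<comment> \<open>Exchanging the finite sums with the integral rests on the integrability of every
    single product; without it the integral would be a default value.\<close>
  also have "\<dots> = (\<Sum>b\<in>S. \<Sum>q<n. \<Sum>p<n. vec_index b p * vec_index b q *
    integral {0..} (\<lambda>t. mat_exp (t \<cdot>\<^sub>m A) $$ (i, p) * mat_exp (t \<cdot>\<^sub>m A\<^sup>T) $$ (q, j)))"
    by (intro integral_unique has_integral_sum has_integral_mult_right integrable_integral
        integrable S finite_lessThan) auto
  finally show ?thesis .
qed

text \<open>An element of both P and Q is counted twice on either side of the identity, an element
  of exactly one of them once.\<close>

lemma modular_on_sum:
  assumes "finite V" "\<And>S. S \<subseteq> V \<Longrightarrow> f S = (\<Sum>b\<in>S. w b)"
  shows "modular_on V f"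
  unfolding modular_on_iff
  using assms by (auto simp: sum.union_inter finite_subset le_infI1)

theorem theorem2:
  fixes n :: nat and A Cbar :: "real mat" and V :: "real Matrix.vec set"
  assumes "A \<in> carrier_mat n n" and "hurwitz_stable A"
    and "finite V" and "V \<subseteq> carrier_vec n"
    and "Cbar \<in> carrier_mat n n"
  shows "modular_on V (\<lambda>S. mat_trace (Cbar * gramian n A S))"
proof (rule modular_on_sum[OF assms(3)])
  fix S assume "S \<subseteq> V"
  with assms(3) have S: "finite S" by (rule rev_finite_subset)
  \<comment> \<open>The contribution of the single vector b to entry (i, j) of the Gramian, free of
    S.\<close>
  let ?w = "\<lambda>b i j. \<Sum>q<n. \<Sum>p<n. vec_index b p * vec_index b q *
    integral {0..} (\<lambda>t. mat_exp (t \<cdot>\<^sub>m A) $$ (i, p) * mat_exp (t \<cdot>\<^sub>m A\<^sup>T) $$ (q, j))"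
  have W: "gramian n A S \<in> carrier_mat n n" by (simp add: gramian_def)
  have "mat_trace (Cbar * gramian n A S) = (\<Sum>i<n. \<Sum>j<n. Cbar $$ (i, j) * gramian n A S $$ (j, i))"
    using assms(5) W by (simp add: mat_trace_def scalar_prod_def lessThan_atLeast0)
  also have "\<dots> = (\<Sum>i<n. \<Sum>j<n. \<Sum>b\<in>S. Cbar $$ (i, j) * ?w b j i)"
    by (simp add: gramian_index[OF assms(1,2) S] sum_distrib_left)
  also have "\<dots> = (\<Sum>i<n. \<Sum>b\<in>S. \<Sum>j<n. Cbar $$ (i, j) * ?w b j i)"
    by (intro sum.cong refl sum.swap)
  also have "\<dots> = (\<Sum>b\<in>S. \<Sum>i<n. \<Sum>j<n. Cbar $$ (i, j) * ?w b j i)"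
    by (rule sum.swap)
  \<comment> \<open>The inner double sum over i and j, which does not mention S, becomes the weight
    \<open>w b\<close> of \<open>modular_on_sum\<close>.\<close>
  finally show "mat_trace (Cbar * gramian n A S) = \<dots>" .
qed

end
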